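(* Let $n\ge 1$, let $\Lambda$ be an $n\times n$ matrix of zeros and ones, let $K=\{0,1,\dots,n-1\}$, and let $\Sigma_\Lambda=\{x\in K^{\mathbb Z}:\Lambda_{x_i,x_{i+1}}=1\ \forall i\in\mathbb Z\}$. Assume that for every $j\in K$ there exists $x\in\Sigma_\Lambda$ with $x_0=j$, and that $(\Sigma_\Lambda,S)$ is topologically mixing, where $S$ is the shift. Then for every potential $\phi\in\mathcal F_\Lambda$, the Gibbs measure $\mu_\phi$ is quasi-invariant by any involution which moves only a finite number of coordinates; that is, for every involution $\sigma$ of $\mathbb Z$ with $\sigma(j)=j$ for all but finitely many $j$, the restrictions of $\mu_\phi$ and $\mu_\phi\circ T_\sigma^{-1}$ to $\Sigma_\Lambda\cap T_\sigma^{-1}\Sigma_\Lambda$ are equivalent measures (mutually absolutely continuous).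
   Context: The shift is $(Sx)_i=x_{i+1}$. $K^{\mathbb Z}$ has the product of the discrete topologies. The system $(\Sigma_\Lambda,S)$ is topologically mixing if for some $M$ one has $(\Lambda^M)_{i,j}>0$ for all $i,j$. For a permutation $\sigma$ of $\mathbb Z$ with finite support, $T_\sigma:K^{\mathbb Z}\to K^{\mathbb Z}$ is defined by $(T_\sigma(\omega))_j=\omega_{\sigma(j)}$ for all $j\in\mathbb Z$. The measure $\mu\circ T_\sigma^{-1}$ restricted to $\Sigma_\Lambda\cap T_\sigma^{-1}\Sigma_\Lambda$ is $A\mapsto\mu(T_\sigma^{-1}A)$ for measurable $A\subset\Sigma_\Lambda\cap T_\sigma^{-1}\Sigma_\Lambda$ (for an involution $\sigma$ this set is invariant under $T_\sigma$). For continuous $\phi:\Sigma_\Lambda\to\mathbb R$ and $k\ge 0$, $\mathrm{var}_k\phi:=\sup\{|\phi(x)-\phi(y)|:x,y\in\Sigma_\Lambda,\ x_j=y_j\ \forall |j|\le k\}$. $\mathcal F_\Lambda$ is the set of continuous $\phi:\Sigma_\Lambda\to\mathbb R$ for which there are constants $b$ and $\alpha\in\,]0,1[$ with $\mathrm{var}_k\phi\le b\alpha^k$ for all $k\ge 0$. A Gibbs measure for a continuous $\phi:\Sigma_\Lambda\to\mathbb R$ is a shift-invariant probability measure $\mu_\phi$ on $\Sigma_\Lambda$ for which there are constants $c_1>0$, $c_2>0$ and $p$ such that $$c_1\le\frac{\mu_\phi(\{y\in\Sigma_\Lambda:y_j=x_j,\ j=0,\dots,m\})}{\exp\left(-pm+\sum_{j=0}^{m-1}\phi(S^jx)\right)}\le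 c_2$$ for every $x\in\Sigma_\Lambda$ and $m\ge 0$. It is a known theorem (Bowen) that if $(\Sigma_\Lambda,S)$ is topologically mixing and $\phi\in\mathcal F_\Lambda$, there exists a unique Gibbs measure $\mu_\phi$ for $\phi$. *)

theory Defs
  imports "HOL-Probability.Probability" "Jordan_Normal_Form.Matrix"
begin

(* A bi-infinite sequence over {0..<n} is a function int => nat with values in {0..<n}. The type
   class topology of int => nat is the product of the discrete topologies of nat, and it induces
   on subsets of {0..<n}^Z the topology of the product of the finite discrete spaces. *)

definition sft :: "nat \<Rightarrow> nat mat \<Rightarrow> (int \<Rightarrow> nat) set" where
  "sft n \<Lambda> = {x. (\<forall>i. x i \<in> {0..<n}) \<and> (\<forall>i. \<Lambda> $$ (x i, x (i + 1)) = 1)}"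

definition shift :: "(int \<Rightarrow> nat) \<Rightarrow> (int \<Rightarrow> nat)" where
  "shift x = (\<lambda>i. x (i + 1))"

definition topologically_mixing :: "nat \<Rightarrow> nat mat \<Rightarrow> bool" where
  "topologically_mixing n \<Lambda> \<longleftrightarrow> (\<exists>M. \<forall>i<n. \<forall>j<n. (\<Lambda> ^\<^sub>m M) $$ (i, j) > 0)"

definition coord_perm :: "(int \<Rightarrow> int) \<Rightarrow> (int \<Rightarrow> nat) \<Rightarrow> (int \<Rightarrow> nat)" where
  "coord_perm \<sigma> \<omega> = (\<lambda>j. \<omega> (\<sigma> j))"

(* The supremum of reals is the intended one whenever \<phi> is continuous on a nonempty
   subshift \<Sigma>: \<Sigma> is compact, so the set below is nonempty and bounded. *)
definition var :: "(int \<Rightarrow> nat) set \<Rightarrow> nat \<Rightarrow> ((int \<Rightarrow> nat) \<Rightarrow> real) \<Rightarrow> real" where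
  "var \<Sigma> k \<phi> =
     Sup {\<bar>\<phi> x - \<phi> y\<bar> |x y. x \<in> \<Sigma> \<and> y \<in> \<Sigma> \<and> (\<forall>j. \<bar>j\<bar> \<le> int k \<longrightarrow> x j = y j)}"

(* Functions are total on int => nat; only their values on \<Sigma> matter. *)
definition potentials :: "(int \<Rightarrow> nat) set \<Rightarrow> ((int \<Rightarrow> nat) \<Rightarrow> real) set" where
  "potentials \<Sigma> = {\<phi>. continuous_on \<Sigma> \<phi> \<and>
     (\<exists>b \<alpha>. 0 < \<alpha> \<and> \<alpha> < 1 \<and> (\<forall>k. var \<Sigma> k \<phi> \<le> b * \<alpha> ^ k))}"

definition gibbs_measure ::
    "(int \<Rightarrow> nat) set \<Rightarrow> ((int \<Rightarrow> nat) \<Rightarrow> real) \<Rightarrow> (int \<Rightarrow> nat) measure \<Rightarrow> bool" where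
  "gibbs_measure \<Sigma> \<phi> \<mu> \<longleftrightarrow>
     sets \<mu> = sets (restrict_space borel \<Sigma>) \<and>
     prob_space \<mu> \<and>
     (\<forall>A \<in> sets \<mu>. emeasure \<mu> (shift -` A \<inter> space \<mu>) = emeasure \<mu> A) \<and>
     (\<exists>c1 c2 p. 0 < c1 \<and> 0 < c2 \<and>
        (\<forall>x \<in> \<Sigma>. \<forall>m::nat.
           let r = measure \<mu> {y \<in> \<Sigma>. \<forall>j \<in> {0..int m}. y j = x j} /
                   exp (- p * real m + (\<Sum>j<m. \<phi> ((shift ^^ j) x)))
           in c1 \<le> r \<and> r \<le> c2))"

definition equivalent_measures :: "'a measure \<Rightarrow> 'a measure \<Rightarrow> bool" where
  "equivalent_measures M N \<longleftrightarrow>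
     sets M = sets N \<and> absolutely_continuous M N \<and> absolutely_continuous N M"

end

theory Submission
  imports Defs
begin

text \<open>If \<open>x\<close> and \<open>T\<^sub>\<sigma> x\<close> both lie in the subshift, they differ only at finitely many
  positions, so the exponential decay of the variations bounds the difference of their Birkhoff sums
  uniformly. By the Gibbs property the cylinders of length \<open>2m + 1\<close> around \<open>x\<close> and
  \<open>T\<^sub>\<sigma> x\<close> then have comparable measures, with a constant independent of \<open>x\<close> and \<open>m\<close>;
  outer regularity extends the comparison to all Borel sets.\<close>

section \<open>Outer regularity on sequence spaces\<close>

text \<open>The library has regularity only for Polish spaces and no metric on \<^typ>\<open>nat\<close>,
  hence the detour through real sequences.\<close>

lemma outer_regular_nat_fun:
  fixes M :: "('i::countable \<Rightarrow> nat) measure"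
  assumes M: "sets M = sets borel" "finite_measure M" and A: "A \<in> sets borel"
  shows "emeasure M A = (INF U\<in>{U. A \<subseteq> U \<and> open U}. emeasure M U)"
proof (rule antisym)
  show "emeasure M A \<le> (INF U\<in>{U. A \<subseteq> U \<and> open U}. emeasure M U)"
    using M by (intro INF_greatest emeasure_mono) auto
next
  \<comment> \<open>\<open>h\<close> embeds sequences of naturals continuously into real sequences,
    and \<open>g\<close> is a Borel left inverse. So the preimage of \<open>A\<close> under
    \<open>g\<close> is Borel, and \<open>h\<close> pulls it back to \<open>A\<close>.\<close>
  define h :: "('i \<Rightarrow> nat) \<Rightarrow> 'i \<Rightarrow> real" where "h x = (\<lambda>i. real (x i))" for x
  define g :: "('i \<Rightarrow> real) \<Rightarrow> 'i \<Rightarrow> nat" where "g y = (\<lambda>i. nat \<lfloor>y i\<rfloor>)" for y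
  have gh: "g (h x) = x" for x
    by (simp add: g_def h_def)
  have cont: "continuous_on UNIV h"
    unfolding h_def
    by (intro continuous_on_coordinatewise_then_product continuous_on_of_nat continuous_on_product_coordinates)
  then have h: "h \<in> M \<rightarrow>\<^sub>M borel"
    using borel_measurable_continuous_onI measurable_cong_sets[OF M(1)] by blast
  have "g \<in> borel \<rightarrow>\<^sub>M borel"
    unfolding g_def
  proof (rule measurable_coordinatewise_then_product)
    fix i
    have "(\<lambda>y. y i) \<in> (borel :: ('i \<Rightarrow> real) measure) \<rightarrow>\<^sub>M borel"
      by (rule measurable_product_coordinates)
    then have "(\<lambda>y. nat \<lfloor>y i\<rfloor>) \<in> (borel :: ('i \<Rightarrow> real) measure) \<rightarrow>\<^sub>M count_space UNIV"
      by measurable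
    then show "(\<lambda>y. nat \<lfloor>y i\<rfloor>) \<in> (borel :: ('i \<Rightarrow> real) measure) \<rightarrow>\<^sub>M borel"
      by (rule measurable_compose) simp
  qed
  then have gA: "g -` A \<in> sets borel"
    using measurable_sets[of g borel borel A] A by simp
  have vimage: "h -` V \<inter> space M = h -` V" for V
    using sets_eq_imp_space_eq[OF M(1)] by simp
  interpret D: finite_measure "distr M borel h"
    using M(2) h by (rule finite_measure.finite_measure_distr)
  \<comment> \<open>Open supersets of the preimage of \<open>A\<close> under \<open>g\<close> pull
    back along \<open>h\<close> to open supersets of \<open>A\<close>, so each value on the right is
    attained by a competitor on the left.\<close>
  have "(INF U\<in>{U. A \<subseteq> U \<and> open U}. emeasure M U)
      \<le> (INF V\<in>{V. g -` A \<subseteq> V \<and> open V}. emeasure (distr M borel h) V)"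
  proof (rule INF_greatest)
    fix V assume V: "V \<in> {V. g -` A \<subseteq> V \<and> open V}"
    then have "A \<subseteq> h -` V" "open (h -` V)"
      using gh cont by (auto intro: open_vimage)
    then have "(INF U\<in>{U. A \<subseteq> U \<and> open U}. emeasure M U) \<le> emeasure M (h -` V)"
      by (intro INF_lower) auto
    also have "\<dots> = emeasure (distr M borel h) V"
      using V by (simp add: emeasure_distr[OF h] vimage borel_open)
    finally show "(INF U\<in>{U. A \<subseteq> U \<and> open U}. emeasure M U) \<le> emeasure (distr M borel h) V" .
  qed
  also have "\<dots> = emeasure (distr M borel h) (g -` A)"
    using outer_regular[of "distr M borel h", OF _ _ gA] by simp
  also have "\<dots> = emeasure M A"
    using gA by (simp add: emeasure_distr[OF h] vimage) (simp add: vimage_def gh)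
  finally show "(INF U\<in>{U. A \<subseteq> U \<and> open U}. emeasure M U) \<le> emeasure M A" .
qed

section \<open>Cylinders and comparison of measures on them\<close>

text \<open>Centred at the origin, so that a permutation preserving the window maps cylinders to
  cylinders; taken in the full sequence space, so that each one is open.\<close>

definition cylinder :: "(int \<Rightarrow> nat) \<Rightarrow> nat \<Rightarrow> (int \<Rightarrow> nat) set" where
  "cylinder x m = {y. \<forall>j. \<bar>j\<bar> \<le> int m \<longrightarrow> y j = x j}"

lemma cylinder_refl [simp]: "x \<in> cylinder x m"
  by (simp add: cylinder_def)

lemma cylinder_antimono: "m \<le> k \<Longrightarrow> cylinder x k \<subseteq> cylinder x m"
  by (auto simp: cylinder_def)

lemma cylinder_eq: "y \<in> cylinder x m \<Longrightarrow> cylinder y m = cylinder x m"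
  by (auto simp: cylinder_def)

lemma open_cylinder: "open (cylinder x m)"
proof -
  have "cylinder x m = {y. \<forall>j\<in>{-int m..int m}. y j \<in> {x j}}"
    by (auto simp: cylinder_def abs_le_iff)
  moreover have "open {y. \<forall>j\<in>{-int m..int m}. y j \<in> {x j}}"
    by (rule product_topology_basis') (simp_all add: Topological_Spaces.open_discrete)
  ultimately show ?thesis by simp
qed

text \<open>A basic open box constrains only finitely many coordinates, and one radius covers them
  all.\<close>

lemma open_contains_cylinder:
  assumes "open U" "x \<in> U"
  obtains m where "cylinder x m \<subseteq> U"
proof -
  obtain X where X: "x \<in> PiE UNIV X" "finite {i. X i \<noteq> UNIV}" "PiE UNIV X \<subseteq> U"
    using product_topology_open_contains_basis[of "\<lambda>_. euclidean" UNIV U x] assms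
    by (auto simp: open_fun_def)
  define m where "m = nat (Max (insert 0 (abs ` {i. X i \<noteq> UNIV})))"
  have "\<bar>i\<bar> \<le> int m" if "X i \<noteq> UNIV" for i
    using X(2) that unfolding m_def by (simp add: Max_ge_iff)
  then have "cylinder x m \<subseteq> PiE UNIV X"
    using X(1) by (fastforce simp: cylinder_def PiE_iff)
  with X(3) show thesis
    using that by blast
qed

lemma open_iff_cylinder: "open U \<longleftrightarrow> (\<forall>x\<in>U. \<exists>m. cylinder x m \<subseteq> U)"
proof
  assume "\<forall>x\<in>U. \<exists>m. cylinder x m \<subseteq> U"
  then show "open U"
    by (meson open_subopen cylinder_refl open_cylinder)
qed (meson open_contains_cylinder)

text \<open>Two cylinders are nested or disjoint, so an open set is covered by disjoint cylinders:
  take around each point the largest one that fits.\<close>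

lemma emeasure_le_if_cylinders_le:
  fixes K :: real
  assumes M: "sets M = sets borel" "finite_measure M" and N: "sets N = sets borel"
    and A: "A \<in> sets borel"
    and le: "\<And>x m. x \<in> A \<Longrightarrow> m0 \<le> m \<Longrightarrow>
      emeasure N (cylinder x m) \<le> ennreal K * emeasure M (cylinder x m)"
  shows "emeasure N A \<le> ennreal K * emeasure M A"
proof -
  have *: "emeasure N A \<le> ennreal K * emeasure M U" if U: "A \<subseteq> U" "open U" for U
  proof -
    \<comment> \<open>The bound \<open>m0\<close> keeps the radius where the hypothesis
      \<open>le\<close> applies; the centres range over \<open>A\<close> alone for the same
      reason.\<close>
    define r where "r x = (LEAST m. m0 \<le> m \<and> cylinder x m \<subseteq> U)" for x
    have r: "m0 \<le> r x \<and> cylinder x (r x) \<subseteq> U" if "x \<in> A" for x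
    proof -
      have "x \<in> U"
        using U(1) that by auto
      then obtain m where "cylinder x m \<subseteq> U"
        using open_contains_cylinder[OF U(2)] by metis
      then have "m0 \<le> max m m0 \<and> cylinder x (max m m0) \<subseteq> U"
        using cylinder_antimono[of m "max m m0" x] by auto
      then show ?thesis
        unfolding r_def by (rule LeastI[where P = "\<lambda>m. m0 \<le> m \<and> cylinder x m \<subseteq> U"])
    qed
    define \<C> where "\<C> = (\<lambda>x. cylinder x (r x)) ` A"
    \<comment> \<open>The cylinder of radius \<open>r x\<close> around \<open>x'\<close> equals the
      one around \<open>x\<close>, which already fits into \<open>U\<close>; minimality of
      \<open>r x'\<close> then forces equal radii.\<close>
    have eq: "cylinder x (r x) = cylinder x' (r x')"
      if x: "x \<in> A" "x' \<in> A" and y: "y \<in> cylinder x (r x)" "y \<in> cylinder x' (r x')"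
        and l: "r x \<le> r x'" for x x' y
    proof -
      have c: "cylinder x' (r x) = cylinder x (r x)"
        using cylinder_eq[OF y(1)] cylinder_eq[of y x' "r x"] cylinder_antimono[OF l, of x'] y(2) by blast
      then have "r x' \<le> r x"
        using r[OF x(1)] unfolding r_def[of x'] by (intro Least_le conjI) auto
      with l c show ?thesis by simp
    qed
    have disj: "disjnt C C'" if C: "C \<in> \<C>" "C' \<in> \<C>" "C \<noteq> C'" for C C'
    proof (rule ccontr)
      assume "\<not> disjnt C C'"
      then obtain y where y: "y \<in> C" "y \<in> C'"
        by (auto simp: disjnt_iff)
      obtain x x' where x: "x \<in> A" "x' \<in> A" and xC: "C = cylinder x (r x)" "C' = cylinder x' (r x')"
        using C by (auto simp: \<C>_def)
      have "C = C'"
      proof (cases "r x \<le> r x'")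
        case True
        then show ?thesis
          using eq[OF x y[unfolded xC]] unfolding xC by simp
      next
        case False
        then show ?thesis
          using eq[OF x(2,1) y(2,1)[unfolded xC]] unfolding xC by simp
      qed
      with C show False by simp
    qed
    have op: "open C" if "C \<in> \<C>" for C
      using that by (auto simp: \<C>_def open_cylinder)
    \<comment> \<open>Disjoint open sets in a second countable space are countably many, so both
      measures of the union are sums over \<open>\<C>\<close>.\<close>
    have "countable \<C>"
      using op disj by (intro countable_disjoint_open_subsets) (simp_all add: pairwise_def)
    moreover have "disjoint_family_on (\<lambda>C. C) \<C>"
      using disj by (auto simp: disjoint_family_on_def disjnt_def)
    moreover have "C \<in> sets borel" if "C \<in> \<C>" for C
      using op[OF that] by (rule borel_open)
    ultimately have
      N\<C>: "emeasure N (\<Union>\<C>) = (\<integral>\<^sup>+C. emeasure N C \<partial>count_space \<C>)" and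
      M\<C>: "emeasure M (\<Union>\<C>) = (\<integral>\<^sup>+C. emeasure M C \<partial>count_space \<C>)"
      using emeasure_UN_countable[of \<C> "\<lambda>C. C"] M N by auto
    have "A \<subseteq> \<Union>\<C>"
      by (auto simp: \<C>_def)
    moreover have "\<Union>\<C> \<in> sets borel"
      using op by (intro borel_open open_Union) simp
    ultimately have "emeasure N A \<le> emeasure N (\<Union>\<C>)"
      using N by (intro emeasure_mono) simp_all
    also have "\<dots> \<le> (\<integral>\<^sup>+C. ennreal K * emeasure M C \<partial>count_space \<C>)"
      unfolding N\<C> using le r by (intro nn_integral_mono) (auto simp: \<C>_def)
    also have "\<dots> = ennreal K * emeasure M (\<Union>\<C>)"
      unfolding M\<C> by (rule nn_integral_cmult) simp
    also have "\<dots> \<le> ennreal K * emeasure M U"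
      using r U M by (intro mult_left_mono emeasure_mono) (auto simp: \<C>_def)
    finally show ?thesis .
  qed
  interpret finite_measure M by fact
  have "emeasure N A \<le> (INF U\<in>{U. A \<subseteq> U \<and> open U}. ennreal K * emeasure M U)"
    using * by (intro INF_greatest) auto
  \<comment> \<open>A constant factor passes through the infimum because multiplication by it is
    monotone and right-continuous; \<open>UNIV\<close> shows that the family is nonempty.\<close>
  also have "\<dots> = ennreal K * (INF U\<in>{U. A \<subseteq> U \<and> open U}. emeasure M U)"
  proof -
    have "continuous (at_right a) ((*) (ennreal K))" for a
      by (simp add: continuous_within ennreal_tendsto_cmult)
    moreover have "mono ((*) (ennreal K))"
      by (simp add: mono_def mult_left_mono)
    moreover have "UNIV \<in> {U. A \<subseteq> U \<and> open U}"
      by simp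
    then have "{U. A \<subseteq> U \<and> open U} \<noteq> {}"
      by blast
    ultimately show ?thesis
      using continuous_at_Inf_mono[of "(*) (ennreal K)" "emeasure M ` {U. A \<subseteq> U \<and> open U}"]
      by (simp add: image_image)
  qed
  also have "\<dots> = ennreal K * emeasure M A"
    using outer_regular_nat_fun[OF M A] by simp
  finally show ?thesis .
qed

section \<open>The subshift: topology and translations\<close>

text \<open>A violated condition involves only two adjacent coordinates, so it persists on a whole
  cylinder.\<close>

lemma closed_sft: "closed (sft n \<Lambda>)"
  unfolding closed_def open_iff_cylinder
proof
  fix x assume "x \<in> - sft n \<Lambda>"
  then obtain i where i: "\<not> (x i \<in> {0..<n} \<and> \<Lambda> $$ (x i, x (i + 1)) = 1)"
    by (auto simp: sft_def)
  have "y \<notin> sft n \<Lambda>" if "y \<in> cylinder x (nat \<bar>i\<bar> + 1)" for y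
  proof -
    have "y i = x i" "y (i + 1) = x (i + 1)"
      using that by (auto simp: cylinder_def)
    then show ?thesis
      using i unfolding sft_def by (metis (mono_tags, lifting) mem_Collect_eq)
  qed
  then show "\<exists>m. cylinder x m \<subseteq> - sft n \<Lambda>"
    by blast
qed

text \<open>A closed subset of a product of finite sets; compactness will bound the
  potential.\<close>

lemma compact_sft: "compact (sft n \<Lambda>)"
proof -
  have "compactin (product_topology (\<lambda>_. euclidean) UNIV) (PiE UNIV (\<lambda>_::int. {0..<n}))"
    by (simp add: compactin_PiE finite_imp_compact)
  then have "compact (PiE UNIV (\<lambda>_::int. {0..<n}))"
    by (simp add: euclidean_product_topology)
  moreover have "sft n \<Lambda> \<subseteq> PiE UNIV (\<lambda>_. {0..<n})"
    by (auto simp: sft_def)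
  ultimately show ?thesis
    using closed_sft[of n \<Lambda>] compact_Int_closed by (metis inf.absorb_iff2)
qed

lemma shift_funpow: "(shift ^^ k) x = (\<lambda>i. x (i + int k))"
  by (induction k) (auto simp: shift_def algebra_simps)

text \<open>Stated for every integer \<open>k\<close>, since centring a word also takes translations
  by negative amounts.\<close>

lemma translate_mem_sft: "x \<in> sft n \<Lambda> \<Longrightarrow> (\<lambda>i. x (i + k)) \<in> sft n \<Lambda>"
proof -
  assume x: "x \<in> sft n \<Lambda>"
  have "\<Lambda> $$ (x (i + k), x (i + 1 + k)) = 1" for i
  proof -
    have "\<Lambda> $$ (x (i + k), x (i + k + 1)) = 1"
      using x by (auto simp: sft_def)
    then show ?thesis by (simp add: add.commute add.left_commute)
  qed
  with x show ?thesis
    by (auto simp: sft_def)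
qed

lemma continuous_on_coord_perm: "continuous_on S (coord_perm \<sigma>)"
  unfolding coord_perm_def
  by (intro continuous_on_coordinatewise_then_product continuous_on_subset[OF continuous_on_product_coordinates])
    simp

text \<open>\<open>coord_perm\<close> makes sense for any index map, so the shift inherits its
  measurability.\<close>

lemma shift_eq_coord_perm: "shift = coord_perm (\<lambda>i. i + 1)"
  by (auto simp: shift_def coord_perm_def)

lemma coord_perm_borel [measurable]: "coord_perm \<sigma> \<in> borel \<rightarrow>\<^sub>M borel"
  by (intro borel_measurable_continuous_onI continuous_on_coord_perm)

section \<open>Variations and Birkhoff sums\<close>

text \<open>\<open>var\<close> is a supremum of reals and dominates its elements only if they are
  bounded above; compactness of \<open>\<Sigma>\<close> supplies such a bound.\<close>

lemma potentials_estimate: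
  assumes "\<phi> \<in> potentials \<Sigma>" "compact \<Sigma>"
  obtains C \<alpha> where "0 < \<alpha>" "\<alpha> < 1" "0 \<le> C"
    "\<And>x y. x \<in> \<Sigma> \<Longrightarrow> y \<in> \<Sigma> \<Longrightarrow> \<bar>\<phi> x - \<phi> y\<bar> \<le> C"
    "\<And>x y k. x \<in> \<Sigma> \<Longrightarrow> y \<in> \<Sigma> \<Longrightarrow> y \<in> cylinder x k \<Longrightarrow> \<bar>\<phi> x - \<phi> y\<bar> \<le> C * \<alpha> ^ k"
proof -
  obtain b \<alpha> where \<alpha>: "0 < \<alpha>" "\<alpha> < 1" and b: "\<And>k. var \<Sigma> k \<phi> \<le> b * \<alpha> ^ k"
    and cont: "continuous_on \<Sigma> \<phi>"
    using assms(1) by (auto simp: potentials_def)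
  obtain B where B: "\<And>x. x \<in> \<Sigma> \<Longrightarrow> \<bar>\<phi> x\<bar> \<le> B"
    using compact_imp_bounded[OF compact_continuous_image[OF cont assms(2)]]
    by (auto simp: bounded_iff)
  have diff: "\<bar>\<phi> x - \<phi> y\<bar> \<le> 2 * B" if "x \<in> \<Sigma>" "y \<in> \<Sigma>" for x y
    using B[OF that(1)] B[OF that(2)] by linarith
  define C where "C = Max {0, b, 2 * B}"
  have C: "0 \<le> C" "b \<le> C" "2 * B \<le> C"
    by (auto simp: C_def)
  have "\<bar>\<phi> x - \<phi> y\<bar> \<le> C * \<alpha> ^ k" if xy: "x \<in> \<Sigma>" "y \<in> \<Sigma>" "y \<in> cylinder x k" for x y k
  proof -
    have "\<bar>\<phi> x - \<phi> y\<bar> \<le> var \<Sigma> k \<phi>"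
      unfolding var_def
    proof (rule cSup_upper)
      show "bdd_above {\<bar>\<phi> x - \<phi> y\<bar> |x y. x \<in> \<Sigma> \<and> y \<in> \<Sigma> \<and> (\<forall>j. \<bar>j\<bar> \<le> int k \<longrightarrow> x j = y j)}"
        using diff by (intro bdd_aboveI[of _ "2 * B"]) auto
      have "\<forall>j. \<bar>j\<bar> \<le> int k \<longrightarrow> x j = y j"
        using xy(3) by (simp add: cylinder_def)
      with xy show "\<bar>\<phi> x - \<phi> y\<bar> \<in> {\<bar>\<phi> x - \<phi> y\<bar> |x y. x \<in> \<Sigma> \<and> y \<in> \<Sigma> \<and> (\<forall>j. \<bar>j\<bar> \<le> int k \<longrightarrow> x j = y j)}"
        by blast
    qed
    also have "\<dots> \<le> C * \<alpha> ^ k"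
      using b[of k] mult_right_mono[OF C(2), of "\<alpha> ^ k"] \<alpha>(1) by (smt (verit) zero_le_power)
    finally show ?thesis .
  qed
  moreover have "\<bar>\<phi> x - \<phi> y\<bar> \<le> C" if "x \<in> \<Sigma>" "y \<in> \<Sigma>" for x y
    using diff[OF that] C by linarith
  ultimately show thesis
    using that \<alpha> C by blast
qed

text \<open>The exponents run through m, ..., 1, 0, ..., m - 1, so two geometric series dominate the
  sum.\<close>

lemma sum_power_abs_le:
  fixes \<alpha> :: real
  assumes "0 < \<alpha>" "\<alpha> < 1"
  shows "(\<Sum>i<2 * m. \<alpha> ^ nat \<bar>int i - int m\<bar>) \<le> 2 / (1 - \<alpha>)"
proof -
  have "(\<Sum>i<2 * m. \<alpha> ^ nat \<bar>int i - int m\<bar>) = (\<Sum>l<m. \<alpha> ^ l + \<alpha> ^ Suc l)"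
  proof (induction m)
    case (Suc m)
    \<comment> \<open>Passing to \<open>Suc m\<close> adds one term at each end: exponent
      \<open>Suc m\<close> at the first index and \<open>m\<close> at the last.\<close>
    have "(\<Sum>i<2 * Suc m. \<alpha> ^ nat \<bar>int i - int (Suc m)\<bar>) =
        (\<Sum>i<Suc (2 * m). \<alpha> ^ nat \<bar>int i - int (Suc m)\<bar>) + \<alpha> ^ m"
      by (simp add: nat_diff_distrib)
    also have "(\<Sum>i<Suc (2 * m). \<alpha> ^ nat \<bar>int i - int (Suc m)\<bar>) =
        \<alpha> ^ Suc m + (\<Sum>i<2 * m. \<alpha> ^ nat \<bar>int i - int m\<bar>)"
      by (subst sum.lessThan_Suc_shift) (simp add: nat_add_distrib)
    finally show ?case
      using Suc by simp
  qed simp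
  also have "\<dots> \<le> (\<Sum>l<m. 2 * \<alpha> ^ l)"
    using assms by (intro sum_mono) (simp add: mult_left_le_one_le)
  also have "\<dots> = 2 * (\<Sum>l<m. \<alpha> ^ l)"
    by (simp add: sum_distrib_left)
  also have "(\<Sum>l<m. \<alpha> ^ l) \<le> 1 / (1 - \<alpha>)"
    using assms by (simp add: sum_gp_strict divide_right_mono)
  finally show ?thesis by simp
qed

text \<open>The translates of \<open>x\<close> and \<open>z\<close> by \<open>k\<close> disagree
  only within distance \<open>N\<close> of \<open>-k\<close>, so the terms decay geometrically in
  |k| and their sum is bounded uniformly in \<open>m\<close>.\<close>

lemma birkhoff_sum_diff_bounded:
  assumes "\<phi> \<in> potentials (sft n \<Lambda>)"
  obtains B where "\<And>x z m. x \<in> sft n \<Lambda> \<Longrightarrow> z \<in> sft n \<Lambda> \<Longrightarrow> (\<And>j. \<bar>j\<bar> > int N \<Longrightarrow> x j = z j) \<Longrightarrow>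
    \<bar>(\<Sum>i<2 * m. \<phi> (\<lambda>l. x (l + (int i - int m)))) - (\<Sum>i<2 * m. \<phi> (\<lambda>l. z (l + (int i - int m))))\<bar> \<le> B"
proof -
  obtain C \<alpha> where \<alpha>: "0 < \<alpha>" "\<alpha> < 1" and "0 \<le> C"
    and C: "\<And>x y. x \<in> sft n \<Lambda> \<Longrightarrow> y \<in> sft n \<Lambda> \<Longrightarrow> \<bar>\<phi> x - \<phi> y\<bar> \<le> C"
    and C\<alpha>: "\<And>x y k. x \<in> sft n \<Lambda> \<Longrightarrow> y \<in> sft n \<Lambda> \<Longrightarrow> y \<in> cylinder x k \<Longrightarrow> \<bar>\<phi> x - \<phi> y\<bar> \<le> C * \<alpha> ^ k"
    using potentials_estimate[OF assms compact_sft] by metis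
  \<comment> \<open>The division makes up for the \<open>Suc N\<close> lost in the radius of
    agreement, and lets the bound exceed \<open>C\<close> when |k| is at most
    \<open>N\<close>.\<close>
  define D where "D = C / \<alpha> ^ Suc N"
  have term_le: "\<bar>\<phi> (\<lambda>l. x (l + k)) - \<phi> (\<lambda>l. z (l + k))\<bar> \<le> D * \<alpha> ^ nat \<bar>k\<bar>"
    if x: "x \<in> sft n \<Lambda>" "z \<in> sft n \<Lambda>" "\<And>j. \<bar>j\<bar> > int N \<Longrightarrow> x j = z j" for x z k
  proof (cases "\<bar>k\<bar> \<le> int N")
    case True
    then have "\<alpha> ^ Suc N \<le> \<alpha> ^ nat \<bar>k\<bar>"
      using \<alpha> by (intro power_decreasing) auto
    then have "C \<le> D * \<alpha> ^ nat \<bar>k\<bar>"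
      using \<alpha> \<open>0 \<le> C\<close> by (simp add: D_def field_simps mult_left_mono)
    then show ?thesis
      using C translate_mem_sft x by (meson order_trans)
  next
    case False
    \<comment> \<open>Translation by \<open>k\<close> takes a position within distance
      \<open>l\<close> of the origin to absolute value at least \<open>Suc N\<close>, where
      \<open>x\<close> and \<open>z\<close> agree.\<close>
    define l where "l = nat \<bar>k\<bar> - Suc N"
    have l: "nat \<bar>k\<bar> = Suc N + l"
      using False by (simp add: l_def)
    have "(\<lambda>l. z (l + k)) \<in> cylinder (\<lambda>l. x (l + k)) l"
      unfolding cylinder_def using l x(3) by auto
    then have "\<bar>\<phi> (\<lambda>l. x (l + k)) - \<phi> (\<lambda>l. z (l + k))\<bar> \<le> C * \<alpha> ^ l"
      using C\<alpha> translate_mem_sft x by meson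
    also have "\<dots> = D * \<alpha> ^ nat \<bar>k\<bar>"
      using \<alpha> unfolding l D_def by (simp add: power_add)
    finally show ?thesis .
  qed
  have "0 \<le> D"
    using \<alpha> \<open>0 \<le> C\<close> by (simp add: D_def)
  show thesis
  proof (rule that)
    fix x z m
    assume x: "x \<in> sft n \<Lambda>" "z \<in> sft n \<Lambda>" "\<And>j. \<bar>j\<bar> > int N \<Longrightarrow> x j = z j"
    have "\<bar>(\<Sum>i<2 * m. \<phi> (\<lambda>l. x (l + (int i - int m)))) - (\<Sum>i<2 * m. \<phi> (\<lambda>l. z (l + (int i - int m))))\<bar>
        \<le> (\<Sum>i<2 * m. \<bar>\<phi> (\<lambda>l. x (l + (int i - int m))) - \<phi> (\<lambda>l. z (l + (int i - int m)))\<bar>)"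
      unfolding sum_subtractf[symmetric] by (rule sum_abs)
    also have "\<dots> \<le> (\<Sum>i<2 * m. D * \<alpha> ^ nat \<bar>int i - int m\<bar>)"
      by (intro sum_mono term_le x)
    also have "\<dots> \<le> D * (2 / (1 - \<alpha>))"
      unfolding sum_distrib_left[symmetric] using \<open>0 \<le> D\<close> \<alpha> by (intro mult_left_mono sum_power_abs_le)
    finally show "\<bar>(\<Sum>i<2 * m. \<phi> (\<lambda>l. x (l + (int i - int m)))) - (\<Sum>i<2 * m. \<phi> (\<lambda>l. z (l + (int i - int m))))\<bar>
        \<le> D * (2 / (1 - \<alpha>))" .
  qed
qed

section \<open>Gibbs measures: measurability, invariance, cylinders\<close>

lemma space_gibbs_measure: "gibbs_measure \<Sigma> \<phi> \<mu> \<Longrightarrow> space \<mu> = \<Sigma>"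
  unfolding gibbs_measure_def by (auto dest!: sets_eq_imp_space_eq simp: space_restrict_space)

lemma sets_gibbs_measure:
  assumes "gibbs_measure \<Sigma> \<phi> \<mu>" "closed \<Sigma>"
  shows "A \<in> sets \<mu> \<longleftrightarrow> A \<in> sets borel \<and> A \<subseteq> \<Sigma>"
  using assms unfolding gibbs_measure_def by (auto simp: sets_restrict_space_iff)

lemma gibbs_measure_measurable:
  assumes "gibbs_measure \<Sigma> \<phi> \<mu>" "f \<in> borel \<rightarrow>\<^sub>M N"
  shows "f \<in> \<mu> \<rightarrow>\<^sub>M N"
proof -
  have "sets \<mu> = sets (restrict_space borel \<Sigma>)"
    using assms by (simp add: gibbs_measure_def)
  then show ?thesis
    using measurable_restrict_space1[OF assms(2)] measurable_cong_sets by blast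
qed

text \<open>Membership in \<open>sets \<mu>\<close> is carried through the induction because
  invariance applies again only to a measurable set.\<close>

lemma gibbs_measure_shift_funpow:
  assumes g: "gibbs_measure (sft n \<Lambda>) \<phi> \<mu>" and A: "A \<in> sets \<mu>"
  shows "(shift ^^ k) -` A \<inter> sft n \<Lambda> \<in> sets \<mu> \<and>
    emeasure \<mu> ((shift ^^ k) -` A \<inter> sft n \<Lambda>) = emeasure \<mu> A"
proof (induction k)
  case 0
  then show ?case
    using A sets.sets_into_space[OF A] space_gibbs_measure[OF g] by (simp add: Int_absorb2)
next
  case (Suc k)
  have eq: "(shift ^^ Suc k) -` A \<inter> sft n \<Lambda> =
      shift -` ((shift ^^ k) -` A \<inter> sft n \<Lambda>) \<inter> space \<mu>"
    using translate_mem_sft[where k = 1]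
    by (auto simp: funpow_Suc_right shift_def space_gibbs_measure[OF g] simp del: funpow.simps)
  have "(shift ^^ Suc k) -` A \<inter> sft n \<Lambda> \<in> sets \<mu>"
    unfolding eq using Suc sets_gibbs_measure[OF g closed_sft]
      measurable_sets[OF gibbs_measure_measurable[OF g coord_perm_borel]]
    unfolding shift_eq_coord_perm by blast
  moreover have "emeasure \<mu> ((shift ^^ Suc k) -` A \<inter> sft n \<Lambda>) = emeasure \<mu> A"
    using Suc.IH g unfolding eq gibbs_measure_def by metis
  ultimately show ?case by (rule conjI)
qed

text \<open>Shift invariance carries the Gibbs bound from words at positions \<open>0, \<dots>, 2m\<close> to centred
  cylinders.\<close>

lemma gibbs_measure_cylinder:
  assumes g: "gibbs_measure (sft n \<Lambda>) \<phi> \<mu>"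
  obtains c1 c2 p :: real where "0 < c1" "0 < c2"
    "\<And>x m. x \<in> sft n \<Lambda> \<Longrightarrow>
      c1 * exp (- p * real (2 * m) + (\<Sum>i<2 * m. \<phi> (\<lambda>l. x (l + (int i - int m)))))
        \<le> measure \<mu> (sft n \<Lambda> \<inter> cylinder x m)"
    "\<And>x m. x \<in> sft n \<Lambda> \<Longrightarrow> measure \<mu> (sft n \<Lambda> \<inter> cylinder x m)
        \<le> c2 * exp (- p * real (2 * m) + (\<Sum>i<2 * m. \<phi> (\<lambda>l. x (l + (int i - int m)))))"
proof -
  obtain c1 c2 p :: real where c: "0 < c1" "0 < c2"
    and G: "\<And>x m. x \<in> sft n \<Lambda> \<Longrightarrow>
      c1 \<le> measure \<mu> {y \<in> sft n \<Lambda>. \<forall>j \<in> {0..int m}. y j = x j} /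
                   exp (- p * real m + (\<Sum>j<m. \<phi> ((shift ^^ j) x))) \<and>
      measure \<mu> {y \<in> sft n \<Lambda>. \<forall>j \<in> {0..int m}. y j = x j} /
                   exp (- p * real m + (\<Sum>j<m. \<phi> ((shift ^^ j) x))) \<le> c2"
    using g unfolding gibbs_measure_def Let_def by blast
  have "c1 * exp (- p * real (2 * m) + (\<Sum>i<2 * m. \<phi> (\<lambda>l. x (l + (int i - int m)))))
        \<le> measure \<mu> (sft n \<Lambda> \<inter> cylinder x m) \<and> measure \<mu> (sft n \<Lambda> \<inter> cylinder x m)
        \<le> c2 * exp (- p * real (2 * m) + (\<Sum>i<2 * m. \<phi> (\<lambda>l. x (l + (int i - int m)))))"
    if x: "x \<in> sft n \<Lambda>" for x m
  proof -
    \<comment> \<open>The word of \<open>x'\<close> at positions 0, ..., 2m is the word of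
      \<open>x\<close> at positions -m, ..., m.\<close>
    define x' where "x' = (\<lambda>l. x (l + (- int m)))"
    have x': "x' \<in> sft n \<Lambda>"
      unfolding x'_def by (rule translate_mem_sft[OF x])
    have "sft n \<Lambda> \<inter> cylinder x m \<in> sets \<mu>"
      by (simp add: sets_gibbs_measure[OF g closed_sft] open_cylinder closed_sft borel_closed borel_open sets.Int)
    then have "emeasure \<mu> ((shift ^^ m) -` (sft n \<Lambda> \<inter> cylinder x m) \<inter> sft n \<Lambda>)
        = emeasure \<mu> (sft n \<Lambda> \<inter> cylinder x m)"
      using gibbs_measure_shift_funpow[OF g] by blast
    moreover have "(shift ^^ m) -` (sft n \<Lambda> \<inter> cylinder x m) \<inter> sft n \<Lambda>
        = {y \<in> sft n \<Lambda>. \<forall>j\<in>{0..int (2 * m)}. y j = x' j}" (is "?L = ?R")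
    proof -
      have "(\<lambda>i. y (i + int m)) \<in> cylinder x m \<longleftrightarrow> (\<forall>j\<in>{0..int (2 * m)}. y j = x' j)" for y
      proof
        assume *: "(\<lambda>i. y (i + int m)) \<in> cylinder x m"
        show "\<forall>j\<in>{0..int (2 * m)}. y j = x' j"
        proof
          fix j assume "j \<in> {0..int (2 * m)}"
          then have "\<bar>j - int m\<bar> \<le> int m" by auto
          with * have "y (j - int m + int m) = x (j - int m)"
            unfolding cylinder_def by blast
          then show "y j = x' j" by (simp add: x'_def)
        qed
      next
        assume *: "\<forall>j\<in>{0..int (2 * m)}. y j = x' j"
        show "(\<lambda>i. y (i + int m)) \<in> cylinder x m"
          unfolding cylinder_def
        proof (intro CollectI allI impI)
          fix j assume "\<bar>j\<bar> \<le> int m"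
          then have "j + int m \<in> {0..int (2 * m)}" by auto
          with * show "y (j + int m) = x j" by (simp add: x'_def)
        qed
      qed
      then show ?thesis
        using translate_mem_sft[where k = "int m"] by (auto simp: shift_funpow)
    qed
    ultimately have "measure \<mu> {y \<in> sft n \<Lambda>. \<forall>j\<in>{0..int (2 * m)}. y j = x' j}
        = measure \<mu> (sft n \<Lambda> \<inter> cylinder x m)"
      by (simp add: measure_def)
    moreover have "(shift ^^ i) x' = (\<lambda>l. x (l + (int i - int m)))" for i
      by (simp add: shift_funpow x'_def algebra_simps)
    ultimately show ?thesis
      \<comment> \<open>In the Gibbs bound a word of 2m + 1 letters goes with 2m terms of the
        Birkhoff sum.\<close>
      using G[OF x', of "2 * m"] by (simp add: le_divide_eq divide_le_eq)
  qed
  with c show thesis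
    using that by blast
qed

text \<open>For equal radii the factors with \<open>p\<close> cancel, and the two Birkhoff sums
  differ by a bounded amount.\<close>

lemma gibbs_measure_cylinder_compare:
  assumes g: "gibbs_measure (sft n \<Lambda>) \<phi> \<mu>" and \<phi>: "\<phi> \<in> potentials (sft n \<Lambda>)"
  obtains K where "\<And>x z m. x \<in> sft n \<Lambda> \<Longrightarrow> z \<in> sft n \<Lambda> \<Longrightarrow> (\<And>j. \<bar>j\<bar> > int N \<Longrightarrow> x j = z j) \<Longrightarrow>
    emeasure \<mu> (sft n \<Lambda> \<inter> cylinder z m) \<le> ennreal K * emeasure \<mu> (sft n \<Lambda> \<inter> cylinder x m)"
proof -
  obtain c1 c2 p :: real where c: "0 < c1" "0 < c2"
    and lower: "\<And>x m. x \<in> sft n \<Lambda> \<Longrightarrow>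
      c1 * exp (- p * real (2 * m) + (\<Sum>i<2 * m. \<phi> (\<lambda>l. x (l + (int i - int m)))))
        \<le> measure \<mu> (sft n \<Lambda> \<inter> cylinder x m)"
    and upper: "\<And>x m. x \<in> sft n \<Lambda> \<Longrightarrow> measure \<mu> (sft n \<Lambda> \<inter> cylinder x m)
        \<le> c2 * exp (- p * real (2 * m) + (\<Sum>i<2 * m. \<phi> (\<lambda>l. x (l + (int i - int m)))))"
    using gibbs_measure_cylinder[OF g] by metis
  obtain B where B: "\<And>x z m. x \<in> sft n \<Lambda> \<Longrightarrow> z \<in> sft n \<Lambda> \<Longrightarrow> (\<And>j. \<bar>j\<bar> > int N \<Longrightarrow> x j = z j) \<Longrightarrow>
    \<bar>(\<Sum>i<2 * m. \<phi> (\<lambda>l. x (l + (int i - int m)))) - (\<Sum>i<2 * m. \<phi> (\<lambda>l. z (l + (int i - int m))))\<bar> \<le> B"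
    using birkhoff_sum_diff_bounded[OF \<phi>] by metis
  interpret prob_space \<mu>
    using g by (simp add: gibbs_measure_def)
  show thesis
  \<comment> \<open>\<open>c2\<close> comes from the upper bound at \<open>z\<close>,
    \<open>c1\<close> from the lower bound at \<open>x\<close>, and \<open>exp B\<close> from the
    Birkhoff sums.\<close>
  proof (rule that[of "c2 / c1 * exp B"])
    fix x z m
    assume x: "x \<in> sft n \<Lambda>" and z: "z \<in> sft n \<Lambda>" and xz: "\<And>j. \<bar>j\<bar> > int N \<Longrightarrow> x j = z j"
    define s where "s y = (\<Sum>i<2 * m. \<phi> (\<lambda>l. y (l + (int i - int m))))" for y
    define q where "q = - p * real (2 * m)"
    have "s z \<le> s x + B"
      using B[OF x z xz, of m] unfolding s_def by linarith
    then have "exp (q + s z) \<le> exp B * exp (q + s x)"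
      unfolding exp_add[symmetric] by simp
    then have "c2 * exp (q + s z) \<le> c2 / c1 * exp B * (c1 * exp (q + s x))"
      using c by (simp add: mult_ac)
    also have "\<dots> \<le> c2 / c1 * exp B * measure \<mu> (sft n \<Lambda> \<inter> cylinder x m)"
      using lower[OF x, of m] c unfolding s_def q_def by (intro mult_left_mono) auto
    finally have "measure \<mu> (sft n \<Lambda> \<inter> cylinder z m)
        \<le> c2 / c1 * exp B * measure \<mu> (sft n \<Lambda> \<inter> cylinder x m)"
      using upper[OF z, of m] unfolding s_def q_def by linarith
    then show "emeasure \<mu> (sft n \<Lambda> \<inter> cylinder z m)
        \<le> ennreal (c2 / c1 * exp B) * emeasure \<mu> (sft n \<Lambda> \<inter> cylinder x m)"
      using c by (simp add: emeasure_eq_measure ennreal_mult'[symmetric] ennreal_leI)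
  qed
qed

section \<open>Involutions of finite support\<close>

text \<open>If \<open>j\<close> is moved then so is \<open>\<sigma> j\<close>; hence a window
  containing all moved points is invariant.\<close>

lemma involution_support_bound:
  fixes \<sigma> :: "int \<Rightarrow> int"
  assumes inv: "\<And>j. \<sigma> (\<sigma> j) = j" and fin: "finite {j. \<sigma> j \<noteq> j}"
  obtains N where "\<And>j. \<bar>j\<bar> > int N \<Longrightarrow> \<sigma> j = j"
    "\<And>j m. N \<le> m \<Longrightarrow> \<bar>\<sigma> j\<bar> \<le> int m \<longleftrightarrow> \<bar>j\<bar> \<le> int m"
proof -
  define N where "N = nat (Max (insert 0 (abs ` {j. \<sigma> j \<noteq> j})))"
  have bound: "\<bar>j\<bar> \<le> int N" if "\<sigma> j \<noteq> j" for j
    using fin that unfolding N_def by (simp add: Max_ge_iff)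
  show thesis
  proof (rule that)
    show "\<sigma> j = j" if "\<bar>j\<bar> > int N" for j
      using bound[of j] that by linarith
    show "\<bar>\<sigma> j\<bar> \<le> int m \<longleftrightarrow> \<bar>j\<bar> \<le> int m" if "N \<le> m" for j m
      using bound[of j] bound[of "\<sigma> j"] inv[of j] that by (cases "\<sigma> j = j") auto
  qed
qed

lemma coord_perm_involution:
  "(\<And>j. \<sigma> (\<sigma> j) = j) \<Longrightarrow> coord_perm \<sigma> (coord_perm \<sigma> x) = x"
  by (simp add: coord_perm_def)

text \<open>Invariance of the window allows reindexing the conditions by \<open>\<sigma>\<close>, so
  the radius is kept.\<close>

lemma coord_perm_vimage_cylinder:
  assumes inv: "\<And>j. \<sigma> (\<sigma> j) = j" and bd: "\<And>j. \<bar>\<sigma> j\<bar> \<le> int m \<longleftrightarrow> \<bar>j\<bar> \<le> int m"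
  shows "coord_perm \<sigma> -` cylinder x m = cylinder (coord_perm \<sigma> x) m"
proof -
  have "(\<forall>j. \<bar>j\<bar> \<le> int m \<longrightarrow> y (\<sigma> j) = x j) \<longleftrightarrow> (\<forall>j. \<bar>j\<bar> \<le> int m \<longrightarrow> y j = x (\<sigma> j))" for y
    using inv bd by metis
  then show ?thesis
    by (auto simp: cylinder_def coord_perm_def)
qed

text \<open>The restriction on \<open>A\<close> puts both a point of \<open>A\<close> and its image
  into the subshift, as the comparison of cylinders requires.\<close>

lemma gibbs_measure_coord_perm_le:
  assumes g: "gibbs_measure (sft n \<Lambda>) \<phi> \<mu>" and \<phi>: "\<phi> \<in> potentials (sft n \<Lambda>)"
    and inv: "\<And>j. \<sigma> (\<sigma> j) = j" and fin: "finite {j. \<sigma> j \<noteq> j}"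
  obtains K where "\<And>A. A \<in> sets borel \<Longrightarrow> A \<subseteq> sft n \<Lambda> \<inter> coord_perm \<sigma> -` sft n \<Lambda> \<Longrightarrow>
    emeasure \<mu> (coord_perm \<sigma> -` A \<inter> sft n \<Lambda>) \<le> ennreal K * emeasure \<mu> A"
proof -
  obtain N where N: "\<And>j. \<bar>j\<bar> > int N \<Longrightarrow> \<sigma> j = j"
    "\<And>j m. N \<le> m \<Longrightarrow> \<bar>\<sigma> j\<bar> \<le> int m \<longleftrightarrow> \<bar>j\<bar> \<le> int m"
    using involution_support_bound[of \<sigma>] inv fin by metis
  obtain K where K: "\<And>x z m. x \<in> sft n \<Lambda> \<Longrightarrow> z \<in> sft n \<Lambda> \<Longrightarrow> (\<And>j. \<bar>j\<bar> > int N \<Longrightarrow> x j = z j) \<Longrightarrow>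
    emeasure \<mu> (sft n \<Lambda> \<inter> cylinder z m) \<le> ennreal K * emeasure \<mu> (sft n \<Lambda> \<inter> cylinder x m)"
    using gibbs_measure_cylinder_compare[OF g \<phi>] by metis
  interpret prob_space \<mu>
    using g by (simp add: gibbs_measure_def)
  note [simp] = space_gibbs_measure[OF g]
  have T: "coord_perm \<sigma> \<in> \<mu> \<rightarrow>\<^sub>M borel" and I: "(\<lambda>x. x) \<in> \<mu> \<rightarrow>\<^sub>M borel"
    by (intro gibbs_measure_measurable[OF g]; simp)+
  \<comment> \<open>Both measures are moved to the Borel sets of the full sequence space, where the
    covering by cylinders applies.\<close>
  let ?M = "distr \<mu> borel (\<lambda>x. x)" and ?N = "distr \<mu> borel (coord_perm \<sigma>)"
  show thesis
  proof (rule that)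
    fix A assume A: "A \<in> sets borel" "A \<subseteq> sft n \<Lambda> \<inter> coord_perm \<sigma> -` sft n \<Lambda>"
    have "emeasure ?N A \<le> ennreal K * emeasure ?M A"
    \<comment> \<open>From radius \<open>N\<close> on, the preimage of a cylinder is again a
      cylinder.\<close>
    proof (rule emeasure_le_if_cylinders_le[OF _ _ _ A(1), of _ _ N])
      show "finite_measure ?M"
        using prob_space_distr[OF I] by (simp add: prob_space_def)
      fix x m assume x: "x \<in> A" and m: "N \<le> m"
      have "emeasure ?N (cylinder x m) = emeasure \<mu> (sft n \<Lambda> \<inter> cylinder (coord_perm \<sigma> x) m)"
        using coord_perm_vimage_cylinder[of \<sigma> m x] N(2)[OF m] inv
        by (simp add: emeasure_distr T borel_open open_cylinder Int_commute)
      also have "\<dots> \<le> ennreal K * emeasure \<mu> (sft n \<Lambda> \<inter> cylinder x m)"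
        using x A(2) N(1) by (intro K) (auto simp: coord_perm_def)
      also have "emeasure \<mu> (sft n \<Lambda> \<inter> cylinder x m) = emeasure ?M (cylinder x m)"
        by (simp add: emeasure_distr I borel_open open_cylinder Int_commute)
      finally show "emeasure ?N (cylinder x m) \<le> ennreal K * emeasure ?M (cylinder x m)" .
    qed simp_all
    moreover have "A \<inter> sft n \<Lambda> = A"
      using A(2) by auto
    ultimately show "emeasure \<mu> (coord_perm \<sigma> -` A \<inter> sft n \<Lambda>) \<le> ennreal K * emeasure \<mu> A"
      using A(1) by (simp add: emeasure_distr T I)
  qed
qed

section \<open>Mutual absolute continuity of the restricted measures\<close>

theorem proposition2:
  fixes n :: nat
    and \<Lambda> :: "nat mat"
    and \<phi> :: "(int \<Rightarrow> nat) \<Rightarrow> real"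
    and \<mu> :: "(int \<Rightarrow> nat) measure"
    and \<sigma> :: "int \<Rightarrow> int"
  assumes "n \<ge> 1"
    and "\<Lambda> \<in> carrier_mat n n"
    and "\<And>i j. i < n \<Longrightarrow> j < n \<Longrightarrow> \<Lambda> $$ (i, j) \<in> {0, 1}"
    and "\<And>j. j \<in> {0..<n} \<Longrightarrow> \<exists>x \<in> sft n \<Lambda>. x 0 = j"
    and "topologically_mixing n \<Lambda>"
    and "\<phi> \<in> potentials (sft n \<Lambda>)"
    and "gibbs_measure (sft n \<Lambda>) \<phi> \<mu>"
    and "\<And>j. \<sigma> (\<sigma> j) = j"
    and "finite {j. \<sigma> j \<noteq> j}"
  shows "equivalent_measures
           (restrict_space \<mu> (sft n \<Lambda> \<inter> coord_perm \<sigma> -` sft n \<Lambda>))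
           (restrict_space (distr \<mu> borel (coord_perm \<sigma>))
              (sft n \<Lambda> \<inter> coord_perm \<sigma> -` sft n \<Lambda>))"
proof -
  let ?\<Sigma> = "sft n \<Lambda>" and ?T = "coord_perm \<sigma>"
  let ?D = "?\<Sigma> \<inter> ?T -` ?\<Sigma>" and ?N = "distr \<mu> borel (coord_perm \<sigma>)"
  note g = \<open>gibbs_measure ?\<Sigma> \<phi> \<mu>\<close>
  note \<mu>_sets = sets_gibbs_measure[OF g closed_sft]
  have T: "?T \<in> \<mu> \<rightarrow>\<^sub>M borel"
    by (rule gibbs_measure_measurable[OF g coord_perm_borel])
  have TT: "?T (?T x) = x" for x
    using assms(8) by (rule coord_perm_involution)
  have \<Sigma>_borel: "?\<Sigma> \<in> sets borel"
    by (simp add: closed_sft borel_closed)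
  have vimage_borel: "?T -` A \<in> sets borel" if "A \<in> sets borel" for A
    using measurable_sets[OF coord_perm_borel[of \<sigma>] that] by simp
  have D: "?D \<in> sets borel"
    using \<Sigma>_borel vimage_borel by blast
  obtain K where K: "\<And>A. A \<in> sets borel \<Longrightarrow> A \<subseteq> ?D \<Longrightarrow>
      emeasure \<mu> (?T -` A \<inter> ?\<Sigma>) \<le> ennreal K * emeasure \<mu> A"
    using gibbs_measure_coord_perm_le[OF g assms(6,8,9)] by blast
  have N: "emeasure ?N A = emeasure \<mu> (?T -` A \<inter> ?\<Sigma>)" if "A \<in> sets borel" for A
    using that by (simp add: emeasure_distr[OF T] space_gibbs_measure[OF g])
  have null_iff: "emeasure \<mu> A = 0 \<longleftrightarrow> emeasure ?N A = 0" if A: "A \<in> sets borel" "A \<subseteq> ?D" for A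
  proof
    assume "emeasure \<mu> A = 0"
    then show "emeasure ?N A = 0"
      using K[OF A] N[OF A(1)] by simp
  next
    assume 0: "emeasure ?N A = 0"
    \<comment> \<open>The comparison is now applied to the preimage of \<open>A\<close>, whose own
      preimage is \<open>A\<close> because \<open>?T\<close> is an involution; this exchanges the
      two measures.\<close>
    have sub: "?T -` A \<subseteq> ?D"
      using A(2) TT by auto
    then have "?T -` A \<inter> ?\<Sigma> = ?T -` A"
      by auto
    moreover have "?T -` (?T -` A) \<inter> ?\<Sigma> = A"
      using A(2) TT by auto
    ultimately show "emeasure \<mu> A = 0"
      using K[OF vimage_borel[OF A(1)] sub] 0 N[OF A(1)] by simp
  qed
  have D\<mu>: "?D \<in> sets \<mu>" and DN: "?D \<in> sets ?N"
    using D \<mu>_sets by auto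
  \<comment> \<open>Both restricted sigma-algebras consist of the Borel subsets of
    \<open>?D\<close>, so equivalence amounts to equality of the null sets.\<close>
  have "A \<in> null_sets (restrict_space \<mu> ?D) \<longleftrightarrow> A \<in> null_sets (restrict_space ?N ?D)" for A
    unfolding null_sets_restrict_space[OF D\<mu>] null_sets_restrict_space[OF DN]
    using null_iff \<mu>_sets by (auto simp: null_sets_def)
  moreover have "A \<in> sets (restrict_space \<mu> ?D) \<longleftrightarrow> A \<in> sets (restrict_space ?N ?D)" for A
    using D\<mu> DN \<mu>_sets by (auto simp: sets_restrict_space_iff)
  ultimately show ?thesis
    unfolding equivalent_measures_def absolutely_continuous_def by blast
qed

end
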